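(* For any fixed integer $k^*\ge 1$, the interval $I_{4m,k^*}$ exists (that is, $k_0(4m)\ge k^*$) for all sufficiently large positive integers $m$, and \[ \lim_{m\to+\infty}\min I_{4m,k^*}=(2k^*-2)\pi\quad\text{and}\quad \lim_{m\to+\infty}\max I_{4m,k^*}=(2k^*-1)\pi . \]
   Context: For a positive integer $n$ let \[ \mathcal{V}^+_n:=\left\{y\in\mathbb{R}: y\ge 0,\ \left|\sum_{k=0}^n\frac{(iy)^k}{k!}\right|\le 1\right\} \] (with the convention $0^0=1$). This set contains $0$ and is a finite union $\mathcal{V}^+_n=\bigcup_{k=1}^{k_0(n)} I_{n,k}$ of $k_0(n)\ge 1$ mutually disjoint non-empty compact intervals (possibly singletons), ordered so that $\min I_{n,1}=0$ and $\max I_{n,k}<\min I_{n,k+1}$ for $k=1,\dots,k_0(n)-1$; that is, the $I_{n,k}$ are the connected components of $\mathcal{V}^+_n$ listed in increasing order. *)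

theory Defs
  imports "HOL-Analysis.Analysis" "HOL-Computational_Algebra.Computational_Algebra"
begin

definition Vplus :: "nat \<Rightarrow> real set" where
  "Vplus n = {y. y \<ge> 0 \<and> cmod (\<Sum>k=0..n. (\<i> * complex_of_real y) ^ k / fact k) \<le> 1}"

definition k0 :: "nat \<Rightarrow> nat" where
  "k0 n = card (components (Vplus n))"

text \<open>
  \<open>Iint n k\<close> is the \<open>k\<close>-th component from the left (counting from \<open>1\<close>), that is, the one with
  exactly \<open>k - 1\<close> components to its left. It is unspecified unless \<open>1 \<le> k \<le> k0 n\<close>;
  theorem \<open>Iint_enumerates\<close> below shows that in this range it is the enumeration intended.
\<close>

definition Iint :: "nat \<Rightarrow> nat \<Rightarrow> real set" where
  "Iint n k = (THE C. C \<in> components (Vplus n) \<and>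
     k = Suc (card {D \<in> components (Vplus n). \<forall>x\<in>D. \<forall>y\<in>C. x < y}))"

lemma zero_in_Vplus: "0 \<in> Vplus n"
proof -
  have "(\<Sum>k=0..n. (0::complex) ^ k / fact k) = 1"
    by (induction n) auto
  then show ?thesis by (simp add: Vplus_def)
qed

lemma closed_Vplus: "closed (Vplus n)"
proof -
  have "Vplus n = {0..} \<inter> {y. cmod (\<Sum>k=0..n. (\<i> * complex_of_real y) ^ k / fact k) \<le> 1}"
    by (auto simp: Vplus_def)
  moreover have "closed {y. cmod (\<Sum>k=0..n. (\<i> * complex_of_real y) ^ k / fact k) \<le> 1}"
    by (intro closed_Collect_le continuous_intros) auto
  ultimately show ?thesis by auto
qed

lemma Taylor_poly_unbounded:
  assumes "n > 0"
  shows "\<exists>r. \<forall>z. r \<le> cmod z \<longrightarrow> 2 \<le> cmod (\<Sum>k=0..n. z ^ k / fact k)"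
proof -
  define p :: "complex poly" where "p = (\<Sum>k=0..n. monom (1 / fact k) k)"
  have ev: "poly p z = (\<Sum>k=0..n. z ^ k / fact k)" for z
    by (simp add: p_def poly_sum poly_monom)
  have c: "coeff p i = (if i \<le> n then 1 / fact i else 0)" for i
    by (simp add: p_def coeff_sum)
  obtain a q where pq: "p = pCons a q" by (cases p)
  have "coeff q 0 = coeff p 1" by (simp add: pq)
  also have "\<dots> = 1" using assms by (simp add: c)
  finally have "q \<noteq> 0" by auto
  from poly_infinity[OF this, of 2 a] show ?thesis
    unfolding pq[symmetric] ev .
qed

lemma compact_Vplus:
  assumes "n > 0"
  shows "compact (Vplus n)"
proof -
  obtain r where r: "\<And>z. r \<le> cmod z \<Longrightarrow> 2 \<le> cmod (\<Sum>k=0..n. z ^ k / fact k)"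
    using Taylor_poly_unbounded[OF assms] by blast
  have "norm y \<le> r" if "y \<in> Vplus n" for y
  proof (rule ccontr)
    assume "\<not> norm y \<le> r"
    with r[of "\<i> * complex_of_real y"] have "2 \<le> cmod (\<Sum>k=0..n. (\<i> * complex_of_real y) ^ k / fact k)"
      by (simp add: norm_mult)
    with that show False by (simp add: Vplus_def)
  qed
  then have "bounded (Vplus n)" by (auto simp: bounded_iff)
  with closed_Vplus show ?thesis by (simp add: compact_eq_bounded_closed)
qed

lemma Vplus_component:
  assumes "n > 0" "C \<in> components (Vplus n)"
  shows "\<exists>a b. a \<le> b \<and> C = {a..b}"
proof -
  have "compact C"
    using assms compact_Vplus compact_components by blast
  moreover have "connected C" "C \<noteq> {}"
    using assms in_components_connected in_components_nonempty by auto
  ultimately show ?thesis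
    by (metis connected_compact_interval_1 atLeastatMost_empty_iff)
qed

lemma finite_level_set:
  assumes "n > 0"
  shows "finite {y::real. cmod (\<Sum>k=0..n. (\<i> * complex_of_real y) ^ k / fact k) = 1}"
proof -
  define A :: "real poly" where "A = (\<Sum>k=0..n. monom (Re (\<i> ^ k) / fact k) k)"
  define B :: "real poly" where "B = (\<Sum>k=0..n. monom (Im (\<i> ^ k) / fact k) k)"
  have eq: "(\<i> * complex_of_real y) ^ k / fact k = of_real (y ^ k / fact k) * \<i> ^ k" for y k
    by (simp add: power_mult_distrib)
  have part: "Re (of_real a * z) = a * Re z" "Im (of_real a * z) = a * Im z" for a z
    by simp_all
  have A: "poly A y = Re (\<Sum>k=0..n. (\<i> * complex_of_real y) ^ k / fact k)" for y
    unfolding eq Re_sum part by (simp add: A_def poly_sum poly_monom mult_ac)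
  have B: "poly B y = Im (\<Sum>k=0..n. (\<i> * complex_of_real y) ^ k / fact k)" for y
    unfolding eq Im_sum part by (simp add: B_def poly_sum poly_monom mult_ac)
  have q: "poly (A\<^sup>2 + B\<^sup>2 - 1) y = (cmod (\<Sum>k=0..n. (\<i> * complex_of_real y) ^ k / fact k))\<^sup>2 - 1" for y
    unfolding poly_diff poly_add poly_power A B cmod_power2 by simp
  obtain r where r: "\<And>z. r \<le> cmod z \<Longrightarrow> 2 \<le> cmod (\<Sum>k=0..n. z ^ k / fact k)"
    using Taylor_poly_unbounded[OF assms] by blast
  have "2 \<le> cmod (\<Sum>k=0..n. (\<i> * complex_of_real \<bar>r\<bar>) ^ k / fact k)"
    by (rule r) (simp add: norm_mult)
  then have "poly (A\<^sup>2 + B\<^sup>2 - 1) \<bar>r\<bar> > 0"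
    unfolding q by (simp add: one_less_power)
  then have "A\<^sup>2 + B\<^sup>2 - 1 \<noteq> 0" by (metis less_irrefl poly_0)
  then have "finite {y. poly (A\<^sup>2 + B\<^sup>2 - 1) y = 0}" by (rule poly_roots_finite)
  then show ?thesis
    by (rule rev_finite_subset) (auto simp: q simp del: poly_add poly_diff poly_power)
qed

lemma finite_components_Vplus:
  assumes "n > 0"
  shows "finite (components (Vplus n))"
proof -
  define f where "f y = cmod (\<Sum>k=0..n. (\<i> * complex_of_real y) ^ k / fact k)" for y
  have contf: "isCont f y" for y
    unfolding f_def by (intro continuous_intros) auto
  have V: "y \<in> Vplus n \<longleftrightarrow> 0 \<le> y \<and> f y \<le> 1" for y
    by (simp add: Vplus_def f_def)
  have left: "Inf C = 0 \<or> f (Inf C) = 1" if C: "C \<in> components (Vplus n)" for C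
  proof (rule ccontr)
    assume neg: "\<not> (Inf C = 0 \<or> f (Inf C) = 1)"
    obtain a b where ab: "a \<le> b" "C = {a..b}"
      using Vplus_component[OF assms C] by blast
    have "C \<subseteq> Vplus n" using C in_components_subset by blast
    with ab neg have a: "a > 0" "f a < 1"
      by (auto simp: V subset_iff less_le)
    have "\<forall>\<^sub>F y in at a. f y < 1"
      using contf[of a] a(2) unfolding isCont_def by (rule order_tendstoD)
    then obtain d where d: "d > 0" "\<And>y. y \<noteq> a \<Longrightarrow> dist y a < d \<Longrightarrow> f y < 1"
      unfolding eventually_at by auto
    define e where "e = min (d / 2) a"
    have e: "0 < e" "e \<le> a" "e < d" using d(1) a(1) by (auto simp: e_def)
    have "y \<in> Vplus n" if "y \<in> {a - e..b}" for y
    proof (cases "y < a")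
      case True
      with d(2)[of y] e that show ?thesis by (auto simp: V dist_real_def)
    next
      case False
      with that ab \<open>C \<subseteq> Vplus n\<close> show ?thesis by auto
    qed
    then have "{a - e..b} \<subseteq> C"
      by (intro components_maximal[OF C]) (use ab e in auto)
    with ab e show False by (auto simp: subset_iff)
  qed
  have inj: "inj_on Inf (components (Vplus n))"
  proof (rule inj_onI)
    fix C D assume C: "C \<in> components (Vplus n)" and D: "D \<in> components (Vplus n)"
      and eq: "Inf C = Inf D"
    from Vplus_component[OF assms C] Vplus_component[OF assms D] eq
    have "C \<inter> D \<noteq> {}" by force
    then show "C = D" using components_nonoverlap[OF C D] by blast
  qed
  have "finite ({0} \<union> {y. f y = 1})"
    using finite_level_set[OF assms] by (simp add: f_def)
  then have "finite (Inf ` components (Vplus n))"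
    by (rule rev_finite_subset) (use left in auto)
  then show ?thesis using inj by (rule finite_imageD)
qed

lemma Vplus_components_linear:
  assumes "n > 0" "C \<in> components (Vplus n)" "D \<in> components (Vplus n)" "C \<noteq> D"
  shows "(\<forall>x\<in>C. \<forall>y\<in>D. x < y) \<or> (\<forall>x\<in>D. \<forall>y\<in>C. x < y)"
proof -
  obtain a b c d where "a \<le> b" "C = {a..b}" "c \<le> d" "D = {c..d}"
    using Vplus_component assms by meson
  moreover have "C \<inter> D = {}"
    using assms components_nonoverlap by blast
  ultimately show ?thesis
    by (auto simp: disjoint_iff)
qed

theorem Iint_enumerates:
  assumes "n > 0"
  shows "bij_betw (Iint n) {1..k0 n} (components (Vplus n))"
    and "k0 n \<ge> 1" "0 \<in> Iint n 1"
    and "\<And>k. k \<in> {1..k0 n} \<Longrightarrow> \<exists>a b. a \<le> b \<and> Iint n k = {a..b}"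
    and "\<And>k l. 1 \<le> k \<Longrightarrow> k < l \<Longrightarrow> l \<le> k0 n \<Longrightarrow> \<forall>x \<in> Iint n k. \<forall>y \<in> Iint n l. x < y"
proof -
  let ?S = "components (Vplus n)"
  define L where "L C = {D \<in> ?S. \<forall>x\<in>D. \<forall>y\<in>C. x < y}" for C
  define r where "r C = Suc (card (L C))" for C
  have fin: "finite ?S" by (rule finite_components_Vplus[OF assms])
  have ne: "C \<noteq> {}" if "C \<in> ?S" for C using that in_components_nonempty by blast
  have mono: "r C < r D" if "C \<in> ?S" "D \<in> ?S" "\<forall>x\<in>C. \<forall>y\<in>D. x < y" for C D
  proof -
    have "L C \<subset> L D"
    proof
      show "L C \<subseteq> L D"
        using that ne[OF that(1)] unfolding L_def by (blast intro: less_trans)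
      have "C \<in> L D" "C \<notin> L C" using that ne[OF that(1)] by (auto simp: L_def)
      then show "L C \<noteq> L D" by blast
    qed
    moreover have "finite (L D)" using fin by (simp add: L_def)
    ultimately show ?thesis by (simp add: r_def psubset_card_mono)
  qed
  have inj: "inj_on r ?S"
  proof (rule inj_onI, rule ccontr)
    fix C D assume CD: "C \<in> ?S" "D \<in> ?S" "r C = r D" "C \<noteq> D"
    from Vplus_components_linear[OF assms CD(1,2,4)] mono[of C D] mono[of D C] CD
    show False by auto
  qed
  have sub: "r ` ?S \<subseteq> {1..k0 n}"
  proof
    fix k assume "k \<in> r ` ?S"
    then obtain C where C: "C \<in> ?S" "k = r C" by blast
    have "C \<notin> L C" using ne[OF C(1)] by (auto simp: L_def)
    then have "L C \<subset> ?S" using C by (auto simp: L_def)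
    then have "card (L C) < card ?S" using fin by (rule psubset_card_mono[rotated])
    then show "k \<in> {1..k0 n}" by (simp add: C r_def k0_def)
  qed
  have img: "r ` ?S = {1..k0 n}"
    using sub by (rule card_subset_eq[rotated]) (simp_all add: card_image[OF inj] k0_def)
  have I: "Iint n (r C) = C" if "C \<in> ?S" for C
    unfolding Iint_def L_def[symmetric] r_def[symmetric]
    by (rule the_equality) (use that inj in \<open>auto dest: inj_onD\<close>)
  have rI: "Iint n k \<in> ?S \<and> r (Iint n k) = k" if "k \<in> {1..k0 n}" for k
    using that I unfolding img[symmetric] by auto
  show "bij_betw (Iint n) {1..k0 n} ?S"
    by (rule bij_betw_byWitness[where f' = r]) (use rI I img in auto)
  obtain Z where Z: "Z \<in> ?S" "0 \<in> Z"
    using zero_in_Vplus[of n] by (metis Union_components UnionE)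
  show k0: "k0 n \<ge> 1"
    using Z(1) sub by fastforce
  have "L Z = {}"
  proof -
    have False if "D \<in> ?S" "\<forall>x\<in>D. x < 0" for D
      using that in_components_subset[OF that(1)] ne[OF that(1)]
      by (force simp: Vplus_def subset_iff)
    then show ?thesis using Z by (auto simp: L_def)
  qed
  then show "0 \<in> Iint n 1"
    using I[OF Z(1)] Z(2) by (simp add: r_def)
  show "\<exists>a b. a \<le> b \<and> Iint n k = {a..b}" if "k \<in> {1..k0 n}" for k
    using rI[OF that] Vplus_component[OF assms] by blast
  show "\<forall>x \<in> Iint n k. \<forall>y \<in> Iint n l. x < y" if "1 \<le> k" "k < l" "l \<le> k0 n" for k l
  proof -
    have k: "Iint n k \<in> ?S" "r (Iint n k) = k" and l: "Iint n l \<in> ?S" "r (Iint n l) = l"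
      using rI[of k] rI[of l] that by auto
    have "Iint n k \<noteq> Iint n l" using k(2) l(2) that by auto
    from Vplus_components_linear[OF assms k(1) l(1) this] mono[OF l(1) k(1)] k l that
    show ?thesis by auto
  qed
qed

end

theory Submission
  imports Defs
begin

text \<open>
  Let \<open>4 dvd n\<close> and let \<open>C\<close>, \<open>S\<close> be the Taylor polynomials of \<open>cos\<close> and \<open>sin\<close> truncated at degree
  \<open>n\<close>, so that the exponential polynomial at \<open>\<i> * y\<close> is \<open>C y + \<i> * S y\<close>. Then \<open>C' = - S\<close> and
  \<open>S' = C - y ^ n / fact n\<close>, so the derivative of \<open>C\<^sup>2 + S\<^sup>2\<close> collapses to
  \<open>- 2 * S y * y ^ n / fact n\<close>. Integrating term by term gives
  \<open>C\<^sup>2 + S\<^sup>2 - 1 = - 2 * y ^ (n + 1) / fact (n + 1) * F y\<close>, where \<open>F\<close> is the sine series with its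
  \<open>k\<close>-th coefficient multiplied by \<open>(n + 1) / (n + 1 + k)\<close> and cut off after degree \<open>n\<close>
  (\<open>cmod_exp_poly_excess\<close>). Hence \<open>Vplus n\<close> is the set of all \<open>y \<ge> 0\<close> with \<open>F y \<ge> 0\<close>: the huge
  cancellation in \<open>\<bar>exp (\<i> * y)\<bar> = 1\<close> has been divided out.

  For fixed \<open>k\<close> the multipliers tend to \<open>1\<close>, and on every bounded interval both \<open>F\<close> and \<open>F'\<close> differ
  from \<open>sin\<close> and \<open>cos\<close> by \<open>O(1 / n)\<close> (\<open>tapered_sin_close\<close>, \<open>tapered_sin'_close\<close>). Closeness of the
  values fixes the sign of \<open>F\<close> away from the multiples of \<open>pi\<close>; closeness of the derivatives makes
  \<open>F\<close> monotone near them. So \<open>F\<close> changes sign exactly once near each \<open>j * pi\<close>, at a point \<open>z j\<close>, and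
  \<open>z 0 = 0\<close>. To the left of \<open>(2 * k - 1 / 2) * pi\<close> the set \<open>Vplus n\<close> is therefore the disjoint
  union of the intervals \<open>{z (2 * i)..z (2 * i + 1)}\<close> with \<open>i < k\<close>; these are its first \<open>k\<close>
  components (\<open>Iint_interval_chain\<close>), and the limits follow from \<open>z j \<approx> j * pi\<close>.
\<close>

section \<open>The modulus of the exponential polynomial on the imaginary axis\<close>

definition cos_poly :: "nat \<Rightarrow> real \<Rightarrow> real" where
  "cos_poly n y = (\<Sum>k\<le>n. cos_coeff k * y ^ k)"

definition sin_poly :: "nat \<Rightarrow> real \<Rightarrow> real" where
  "sin_poly n y = (\<Sum>k\<le>n. sin_coeff k * y ^ k)"

text \<open>
  The factor produced by integrating \<open>y ^ n * y ^ k\<close> and dividing by \<open>y ^ (n + 1) / (n + 1)\<close>. The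
  value \<open>0\<close> beyond degree \<open>n\<close> turns the truncated sums into full power series, so that one estimate
  covers the change of the coefficients and the omitted tail.
\<close>

definition taper :: "nat \<Rightarrow> nat \<Rightarrow> real" where
  "taper n k = (if k \<le> n then real (n + 1) / real (n + 1 + k) else 0)"

definition tapered_sin :: "nat \<Rightarrow> real \<Rightarrow> real" where
  "tapered_sin n y = (\<Sum>k\<le>n. taper n k * sin_coeff k * y ^ k)"

definition tapered_sin' :: "nat \<Rightarrow> real \<Rightarrow> real" where
  "tapered_sin' n y = (\<Sum>k<n. taper n (Suc k) * cos_coeff k * y ^ k)"

lemma ii_power_over_fact:
  "\<i> ^ k / fact k = Complex (cos_coeff k) (sin_coeff k)"
proof (induction k)
  case 0
  then show ?case by (simp add: complex_eq_iff)
next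
  case (Suc k)
  have "\<i> ^ Suc k / fact (Suc k) = \<i> / of_nat (Suc k) * (\<i> ^ k / fact k)"
    by (simp add: field_simps)
  also have "\<dots> = \<i> * Complex (cos_coeff k) (sin_coeff k) / of_nat (Suc k)"
    unfolding Suc by simp
  also have "\<dots> = Complex (cos_coeff (Suc k)) (sin_coeff (Suc k))"
    by (simp add: complex_eq_iff cos_coeff_Suc sin_coeff_Suc del: of_nat_Suc)
  finally show ?case .
qed

lemma exp_poly_ii:
  "(\<Sum>k=0..n. (\<i> * complex_of_real y) ^ k / fact k) = Complex (cos_poly n y) (sin_poly n y)"
proof -
  have "(\<i> * complex_of_real y) ^ k / fact k = Complex (cos_coeff k * y ^ k) (sin_coeff k * y ^ k)" for k
  proof -
    have "(\<i> * complex_of_real y) ^ k / fact k = (\<i> ^ k / fact k) * complex_of_real (y ^ k)"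
      by (simp add: power_mult_distrib)
    then show ?thesis unfolding ii_power_over_fact by (simp add: complex_eq_iff)
  qed
  then show ?thesis
    by (simp add: complex_eq_iff cos_poly_def sin_poly_def atLeast0AtMost)
qed

lemma has_derivative_power_sum:
  fixes a b :: "nat \<Rightarrow> real"
  assumes "\<And>k. real (Suc k) * a (Suc k) = b k"
  shows "((\<lambda>y. \<Sum>k\<le>n. a k * y ^ k) has_real_derivative (\<Sum>k<n. b k * y ^ k)) (at y)"
proof -
  have "((\<lambda>y. \<Sum>k\<le>n. a k * y ^ k) has_real_derivative
      (\<Sum>k\<le>n. a k * (real k * y ^ (k - Suc 0)))) (at y)"
    by (intro DERIV_sum DERIV_cmult DERIV_pow[unfolded One_nat_def])
  also have "(\<Sum>k\<le>n. a k * (real k * y ^ (k - Suc 0))) = (\<Sum>k<n. b k * y ^ k)"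
    by (subst sum.atMost_shift) (simp add: assms[symmetric] mult_ac del: of_nat_Suc)
  finally show ?thesis .
qed

lemma cos_poly_deriv:
  "(cos_poly n has_real_derivative - (sin_poly n y - sin_coeff n * y ^ n)) (at y)"
proof -
  have "(cos_poly n has_real_derivative (\<Sum>k<n. - sin_coeff k * y ^ k)) (at y)"
    unfolding cos_poly_def[abs_def]
    by (rule has_derivative_power_sum) (simp add: cos_coeff_Suc del: of_nat_Suc)
  also have "(\<Sum>k<n. - sin_coeff k * y ^ k) = - (sin_poly n y - sin_coeff n * y ^ n)"
    by (simp add: sin_poly_def sum_negf lessThan_Suc_atMost[symmetric])
  finally show ?thesis .
qed

lemma sin_poly_deriv:
  "(sin_poly n has_real_derivative cos_poly n y - cos_coeff n * y ^ n) (at y)"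
proof -
  have "(sin_poly n has_real_derivative (\<Sum>k<n. cos_coeff k * y ^ k)) (at y)"
    unfolding sin_poly_def[abs_def]
    by (rule has_derivative_power_sum) (simp add: sin_coeff_Suc del: of_nat_Suc)
  also have "(\<Sum>k<n. cos_coeff k * y ^ k) = cos_poly n y - cos_coeff n * y ^ n"
    by (simp add: cos_poly_def lessThan_Suc_atMost[symmetric])
  finally show ?thesis .
qed

lemma tapered_sin_deriv:
  "(tapered_sin n has_real_derivative tapered_sin' n y) (at y)"
  unfolding tapered_sin_def[abs_def] tapered_sin'_def
  by (rule has_derivative_power_sum) (simp add: sin_coeff_Suc del: of_nat_Suc)

text \<open>
  This is the origin of the tapering: \<open>taper n k\<close> cancels against the factor \<open>n + 1 + k\<close> from
  differentiating \<open>y ^ (n + 1 + k)\<close>.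
\<close>

lemma tapered_sin_primitive:
  "((\<lambda>y. y ^ (n + 1) * tapered_sin n y) has_real_derivative
     real (n + 1) * y ^ n * sin_poly n y) (at y)"
proof -
  have expand: "y ^ (n + 1) * tapered_sin n y
      = (\<Sum>k\<le>n. taper n k * sin_coeff k * y ^ (n + 1 + k))" for y
    by (simp add: tapered_sin_def sum_distrib_left power_add mult_ac)
  have "((\<lambda>y. \<Sum>k\<le>n. taper n k * sin_coeff k * y ^ (n + 1 + k)) has_real_derivative
      (\<Sum>k\<le>n. taper n k * sin_coeff k * (real (n + 1 + k) * y ^ (n + k)))) (at y)"
  proof (intro DERIV_sum DERIV_cmult)
    show "((\<lambda>y. y ^ (n + 1 + k)) has_real_derivative real (n + 1 + k) * y ^ (n + k)) (at y)" for k
      using DERIV_pow[of "n + 1 + k" y] by simp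
  qed
  also have "(\<Sum>k\<le>n. taper n k * sin_coeff k * (real (n + 1 + k) * y ^ (n + k)))
      = (\<Sum>k\<le>n. real (n + 1) * y ^ n * (sin_coeff k * y ^ k))"
  proof (rule sum.cong[OF refl])
    fix k assume "k \<in> {..n}"
    then have "taper n k * real (n + 1 + k) = real (n + 1)"
      by (simp add: taper_def)
    then show "taper n k * sin_coeff k * (real (n + 1 + k) * y ^ (n + k))
      = real (n + 1) * y ^ n * (sin_coeff k * y ^ k)"
      by (simp add: power_add mult.commute mult.left_commute)
  qed
  finally show ?thesis
    unfolding expand by (simp only: sin_poly_def sum_distrib_left)
qed

text \<open>
  Both sides have the same derivative and vanish at \<open>0\<close>. Divisibility by \<open>4\<close> enters through the top
  coefficients: the sine coefficient of degree \<open>n\<close> is \<open>0\<close> and the cosine coefficient is positive.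
\<close>

lemma cmod_exp_poly_excess:
  assumes "4 dvd n"
  shows "(cos_poly n y)\<^sup>2 + (sin_poly n y)\<^sup>2 - 1 = - 2 * y ^ (n + 1) / fact (n + 1) * tapered_sin n y"
proof -
  obtain m where n: "n = 4 * m" using assms by blast
  have top: "sin_coeff n = 0" "cos_coeff n = 1 / fact n"
    by (simp_all add: n sin_coeff_def cos_coeff_def)
  define D where "D y = (cos_poly n y)\<^sup>2 + (sin_poly n y)\<^sup>2
    + 2 / fact (n + 1) * (y ^ (n + 1) * tapered_sin n y)" for y
  have "(D has_real_derivative 0) (at y)" for y
  proof -
    have "(D has_real_derivative
        2 * cos_poly n y * - (sin_poly n y - sin_coeff n * y ^ n)
        + 2 * sin_poly n y * (cos_poly n y - cos_coeff n * y ^ n)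
        + 2 / fact (n + 1) * (real (n + 1) * y ^ n * sin_poly n y)) (at y)"
      unfolding D_def[abs_def]
      by (rule derivative_eq_intros cos_poly_deriv sin_poly_deriv tapered_sin_primitive refl | simp)+
    also have "2 * cos_poly n y * - (sin_poly n y - sin_coeff n * y ^ n)
        + 2 * sin_poly n y * (cos_poly n y - cos_coeff n * y ^ n)
        + 2 / fact (n + 1) * (real (n + 1) * y ^ n * sin_poly n y) = 0"
    proof -
      have "2 / fact (n + 1) * real (n + 1) = (2 / fact n :: real)"
        by (simp add: divide_simps)
      then have "2 / fact (n + 1) * (real (n + 1) * y ^ n * sin_poly n y)
          = 2 / fact n * y ^ n * sin_poly n y"
        by (metis mult.assoc)
      then show ?thesis
        unfolding top by (simp add: algebra_simps)
    qed
    finally show ?thesis .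
  qed
  then have "D y = D 0" by (intro DERIV_isconst_all) blast
  also have "D 0 = 1"
    by (simp add: D_def cos_poly_def sin_poly_def sum.atMost_shift)
  finally show ?thesis by (simp add: D_def)
qed

lemma mem_Vplus_iff:
  assumes "4 dvd n"
  shows "y \<in> Vplus n \<longleftrightarrow> y \<ge> 0 \<and> tapered_sin n y \<ge> 0"
proof (cases "y > 0")
  case True
  have "y \<in> Vplus n \<longleftrightarrow> (cos_poly n y)\<^sup>2 + (sin_poly n y)\<^sup>2 - 1 \<le> 0"
    using True by (simp add: Vplus_def exp_poly_ii cmod_def)
  also have "\<dots> \<longleftrightarrow> 0 \<le> (2 * y ^ (n + 1) / fact (n + 1)) * tapered_sin n y"
    unfolding cmod_exp_poly_excess[OF assms] by simp
  also have "\<dots> \<longleftrightarrow> 0 \<le> tapered_sin n y"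
  proof -
    have "0 < 2 * y ^ (n + 1) / fact (n + 1)" using True by simp
    then show ?thesis by (metis zero_le_mult_iff less_le_not_le less_imp_le)
  qed
  finally show ?thesis using True by simp
next
  case False
  have "tapered_sin n 0 = 0" by (simp add: tapered_sin_def sum.atMost_shift)
  with False show ?thesis
    using zero_in_Vplus[of n] by (cases "y = 0") (auto simp: Vplus_def)
qed

section \<open>Uniform convergence to sine and cosine\<close>

text \<open>
  The difference of the two series is dominated term by term by
  \<open>(k + 1) / N * R ^ k / fact k\<close>, and these terms add up to \<open>(R + 1) * exp R / N\<close>. The slack \<open>k + 1\<close>
  instead of \<open>k\<close> accommodates the index shift caused by differentiation.
\<close>

lemma reweighted_series_close:
  fixes a c :: "nat \<Rightarrow> real"
  assumes a: "\<And>k. \<bar>a k\<bar> \<le> 1 / fact k"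
    and c: "\<And>k. \<bar>c k - 1\<bar> \<le> real (k + 1) / N"
    and y: "\<bar>y\<bar> \<le> R"
    and s: "(\<lambda>k. a k * y ^ k) sums s" and t: "(\<lambda>k. c k * a k * y ^ k) sums t"
  shows "\<bar>t - s\<bar> \<le> (R + 1) * exp R / N"
proof -
  have e: "(\<lambda>k. R ^ k / fact k) sums exp R"
    using exp_converges[of R] by (simp add: divide_inverse mult.commute)
  have "(\<lambda>k. real (Suc k) * R ^ Suc k / fact (Suc k)) sums (R * exp R)"
    using sums_mult[OF e, of R] by (simp add: field_simps del: of_nat_Suc)
  then have "(\<lambda>k. real k * R ^ k / fact k) sums (R * exp R)"
    by (subst (asm) sums_Suc_iff) simp
  from sums_add[OF this e] have "(\<lambda>k. real (k + 1) * (R ^ k / fact k)) sums ((R + 1) * exp R)"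
    by (simp add: field_simps)
  then have major: "(\<lambda>k. real (k + 1) / N * (R ^ k / fact k)) sums ((R + 1) * exp R / N)"
    using sums_divide[of "\<lambda>k. real (k + 1) * (R ^ k / fact k)" "(R + 1) * exp R" N]
    by (simp only: times_divide_eq_left)
  have diff: "(\<lambda>k. (c k - 1) * a k * y ^ k) sums (t - s)"
    using sums_diff[OF t s] by (simp add: algebra_simps)
  have bound: "norm ((c k - 1) * a k * y ^ k) \<le> real (k + 1) / N * (R ^ k / fact k)" for k
  proof -
    have "\<bar>c k - 1\<bar> * (\<bar>a k\<bar> * \<bar>y\<bar> ^ k) \<le> real (k + 1) / N * (1 / fact k * R ^ k)"
      using c[of k] a[of k] y by (intro mult_mono power_mono) (auto intro: order_trans[OF abs_ge_zero])
    then show ?thesis by (simp add: abs_mult power_abs mult.assoc)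
  qed
  have "norm (t - s) \<le> (R + 1) * exp R / N"
    using norm_suminf_le[OF bound sums_summable[OF major]] diff major
    by (simp add: sums_iff)
  then show ?thesis by simp
qed

text \<open>Beyond degree \<open>n\<close> the left side is \<open>1\<close>, and there \<open>k / n\<close> exceeds \<open>1\<close> anyway.\<close>

lemma taper_close_1:
  assumes "n > 0"
  shows "\<bar>taper n k - 1\<bar> \<le> real k / real n"
proof (cases "k \<le> n")
  case True
  then have "taper n k - 1 = - (real k / real (n + 1 + k))"
    by (simp add: taper_def field_simps)
  also have "\<bar>- (real k / real (n + 1 + k))\<bar> \<le> real k / real n"
    using assms by (simp add: frac_le)
  finally show ?thesis .
qed (use assms in \<open>simp add: taper_def\<close>)

lemma tapered_sin_close:
  assumes "n > 0" "\<bar>y\<bar> \<le> R"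
  shows "\<bar>tapered_sin n y - sin y\<bar> \<le> (R + 1) * exp R / real n"
proof (rule reweighted_series_close)
  show "\<bar>sin_coeff k\<bar> \<le> 1 / fact k" for k by (simp add: sin_coeff_def)
  show "\<bar>taper n k - 1\<bar> \<le> real (k + 1) / real n" for k
    using taper_close_1[OF assms(1), of k] by (rule order_trans) (simp add: divide_right_mono)
  show "(\<lambda>k. sin_coeff k * y ^ k) sums sin y"
    using sin_converges[of y] by simp
  show "(\<lambda>k. taper n k * sin_coeff k * y ^ k) sums tapered_sin n y"
    unfolding tapered_sin_def by (rule sums_finite) (auto simp: taper_def)
qed (rule assms)

lemma tapered_sin'_close:
  assumes "n > 0" "\<bar>y\<bar> \<le> R"
  shows "\<bar>tapered_sin' n y - cos y\<bar> \<le> (R + 1) * exp R / real n"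
proof (rule reweighted_series_close)
  show "\<bar>cos_coeff k\<bar> \<le> 1 / fact k" for k by (simp add: cos_coeff_def)
  show "\<bar>taper n (Suc k) - 1\<bar> \<le> real (k + 1) / real n" for k
    using taper_close_1[OF assms(1), of "Suc k"] by simp
  show "(\<lambda>k. cos_coeff k * y ^ k) sums cos y"
    using cos_converges[of y] by simp
  show "(\<lambda>k. taper n (Suc k) * cos_coeff k * y ^ k) sums tapered_sin' n y"
    unfolding tapered_sin'_def by (rule sums_finite) (auto simp: taper_def)
qed (rule assms)

section \<open>Zeros of the tapered sine\<close>

text \<open>
  On \<open>d \<le> \<bar>t\<bar> \<le> pi / 2\<close> the value of \<open>sin\<close> is at least \<open>sin d\<close> in modulus, which settles the sign of
  \<open>G\<close>; on \<open>\<bar>t\<bar> \<le> d\<close> the derivative is positive because \<open>cos t \<ge> cos d\<close>, so \<open>G\<close> increases through a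
  single zero \<open>s\<close>.
\<close>

lemma perturbed_sin_sign:
  fixes G G' :: "real \<Rightarrow> real"
  assumes d: "0 < d" "d < pi / 2"
    and der: "\<And>t. (G has_real_derivative G' t) (at t)"
    and G: "\<And>t. \<bar>t\<bar> \<le> pi / 2 \<Longrightarrow> \<bar>G t - sin t\<bar> < sin d"
    and G': "\<And>t. \<bar>t\<bar> \<le> pi / 2 \<Longrightarrow> \<bar>G' t - cos t\<bar> < cos d"
  obtains s where "\<bar>s\<bar> < d" "\<And>t. \<bar>t\<bar> \<le> pi / 2 \<Longrightarrow> sgn (G t) = sgn (t - s)"
proof -
  have pos: "G t > 0" if "d \<le> t" "t \<le> pi / 2" for t
  proof -
    have "sin d \<le> sin t" using d that by (intro sin_monotone_2pi_le) auto
    with G[of t] d that show ?thesis by (simp add: abs_less_iff)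
  qed
  have neg: "G t < 0" if "t \<le> - d" "- (pi / 2) \<le> t" for t
  proof -
    have "sin t \<le> sin (- d)" using d that by (intro sin_monotone_2pi_le) auto
    with G[of t] d that show ?thesis by (simp add: abs_less_iff)
  qed
  have inc: "G t < G u" if "- d \<le> t" "t < u" "u \<le> d" for t u
  proof (rule DERIV_pos_imp_increasing[OF \<open>t < u\<close>])
    fix x assume x: "t \<le> x" "x \<le> u"
    have "cos d \<le> cos x"
      using cos_monotone_0_pi_le[of "\<bar>x\<bar>" d] d x that by (auto simp: abs_le_iff)
    moreover have "\<bar>x\<bar> \<le> pi / 2" using d x that by auto
    ultimately have "G' x > 0" using G'[of x] by (simp add: abs_less_iff)
    with der show "\<exists>y. DERIV G x :> y \<and> y > 0" by blast
  qed
  have "continuous_on {-d..d} G"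
    using der by (meson DERIV_isCont continuous_at_imp_continuous_on)
  then obtain s where s: "- d \<le> s" "s \<le> d" "G s = 0"
    using IVT'[of G "-d" 0 d] neg[of "-d"] pos[of d] d by auto
  show thesis
  proof
    show "\<bar>s\<bar> < d" using s neg[of "-d"] pos[of d] d by (cases "s = d"; cases "s = - d") auto
    fix t :: real assume t: "\<bar>t\<bar> \<le> pi / 2"
    show "sgn (G t) = sgn (t - s)"
    proof (cases t s rule: linorder_cases)
      case less
      with t s inc[of t s] neg[of t] have "G t < 0" by (cases "t \<le> - d") auto
      with less show ?thesis by simp
    next
      case greater
      with t s inc[of s t] pos[of t] have "G t > 0" by (cases "t \<ge> d") auto
      with greater show ?thesis by simp
    qed (use s in simp)
  qed
qed

text \<open>
  Translation by \<open>j * pi\<close> multiplies sine and cosine by \<open>(-1) ^ j\<close>, which reduces every zero of sine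
  to the one at \<open>0\<close>.
\<close>

lemma tapered_sin_sign:
  assumes d: "0 < d" "d < pi / 2"
    and n: "n > 0" "((real j + 1) * pi + 1) * exp ((real j + 1) * pi) / real n < min (sin d) (cos d)"
  obtains z where "\<bar>z - real j * pi\<bar> < d"
    "\<And>y. \<bar>y - real j * pi\<bar> \<le> pi / 2 \<Longrightarrow> sgn (tapered_sin n y) = (-1) ^ j * sgn (y - z)"
proof -
  define G where "G t = (-1) ^ j * tapered_sin n (real j * pi + t)" for t
  define G' where "G' t = (-1) ^ j * tapered_sin' n (real j * pi + t)" for t
  have sgn1: "(-1) ^ j * ((-1) ^ j * x) = (x::real)" for x
    by (simp add: mult.assoc[symmetric] power_mult_distrib[symmetric])
  have sc: "sin (real j * pi + t) = (-1) ^ j * sin t" "cos (real j * pi + t) = (-1) ^ j * cos t" for t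
    by (simp_all add: sin_add cos_add mult.commute[of _ pi])
  have range: "\<bar>real j * pi + t\<bar> \<le> (real j + 1) * pi" if "\<bar>t\<bar> \<le> pi / 2" for t
  proof -
    have "\<bar>real j * pi + t\<bar> \<le> real j * pi + \<bar>t\<bar>"
      by (rule order_trans[OF abs_triangle_ineq]) simp
    with that pi_gt_zero show ?thesis by (simp add: distrib_right)
  qed
  have absj: "\<bar>(-1) ^ j * x - y\<bar> = \<bar>x - (-1) ^ j * y\<bar>" for x y :: real
    by (cases "even j") auto
  obtain s where s: "\<bar>s\<bar> < d" "\<And>t. \<bar>t\<bar> \<le> pi / 2 \<Longrightarrow> sgn (G t) = sgn (t - s)"
  proof (rule perturbed_sin_sign[OF d])
    show "(G has_real_derivative G' t) (at t)" for t
      unfolding G_def[abs_def] G'_def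
      by (auto intro!: derivative_eq_intros DERIV_chain2[OF tapered_sin_deriv])
    show "\<bar>G t - sin t\<bar> < sin d" if "\<bar>t\<bar> \<le> pi / 2" for t
      unfolding G_def absj sc[symmetric]
      using tapered_sin_close[OF n(1) range[OF that]] n(2) by simp
    show "\<bar>G' t - cos t\<bar> < cos d" if "\<bar>t\<bar> \<le> pi / 2" for t
      unfolding G'_def absj sc[symmetric]
      using tapered_sin'_close[OF n(1) range[OF that]] n(2) by simp
  qed blast
  show thesis
  proof
    show "\<bar>(real j * pi + s) - real j * pi\<bar> < d" using s by simp
    fix y assume "\<bar>y - real j * pi\<bar> \<le> pi / 2"
    then have "sgn (G (y - real j * pi)) = sgn (y - (real j * pi + s))"
      using s(2)[of "y - real j * pi"] by (simp add: algebra_simps)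
    moreover have "tapered_sin n y = (-1) ^ j * G (y - real j * pi)"
      by (simp add: G_def sgn1)
    ultimately show "sgn (tapered_sin n y) = (-1) ^ j * sgn (y - (real j * pi + s))"
      by (simp add: sgn_mult)
  qed
qed

section \<open>The first components\<close>

text \<open>
  Each \<open>y\<close> in the range lies in exactly one cell of length \<open>pi\<close> centred at some \<open>j * pi\<close> with
  \<open>j < 2 * k\<close>, and \<open>z j\<close> is the only zero in it. Membership then reads \<open>z j \<le> y\<close> for even \<open>j\<close> and
  \<open>y \<le> z j\<close> for odd \<open>j\<close>, which says that \<open>y\<close> lies in the interval having \<open>z j\<close> as an endpoint.
\<close>

lemma Vplus_left_part:
  fixes z :: "nat \<Rightarrow> real"
  assumes n: "4 dvd n"
    and near: "\<And>j. j < 2 * k \<Longrightarrow> \<bar>z j - real j * pi\<bar> < pi / 2"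
    and sg: "\<And>j y. j < 2 * k \<Longrightarrow> \<bar>y - real j * pi\<bar> \<le> pi / 2 \<Longrightarrow>
      sgn (tapered_sin n y) = (-1) ^ j * sgn (y - z j)"
    and y: "0 \<le> y" "y < (2 * real k - 1 / 2) * pi"
  shows "y \<in> Vplus n \<longleftrightarrow> (\<exists>i<k. z (2 * i) \<le> y \<and> y \<le> z (2 * i + 1))"
proof -
  \<comment> \<open>the index of the cell containing \<open>y\<close>, that is \<open>y / pi\<close> rounded to the nearest integer\<close>
  define j where "j = nat \<lfloor>y / pi + 1 / 2\<rfloor>"
  have "real j = of_int \<lfloor>y / pi + 1 / 2\<rfloor>"
    using y by (simp add: j_def)
  then have "real j \<le> y / pi + 1 / 2" "y / pi + 1 / 2 < real j + 1" by linarith+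
  then have "(real j - 1 / 2) * pi \<le> y" "y < (real j + 1 / 2) * pi"
    by (simp_all add: field_simps)
  then have cell: "real j * pi - pi / 2 \<le> y" "y < real j * pi + pi / 2"
    by (simp_all add: algebra_simps)
  have "(real j - 1 / 2) * pi < (2 * real k - 1 / 2) * pi"
    using \<open>(real j - 1 / 2) * pi \<le> y\<close> y by linarith
  then have jk: "j < 2 * k" by simp
  have V: "y \<in> Vplus n \<longleftrightarrow> 0 \<le> (-1) ^ j * sgn (y - z j)"
  proof -
    have "\<bar>y - real j * pi\<bar> \<le> pi / 2" using cell by linarith
    then have "sgn (tapered_sin n y) = (-1) ^ j * sgn (y - z j)" by (rule sg[OF jk])
    then show ?thesis
      using y mem_Vplus_iff[OF n, of y] by (metis zero_le_sgn_iff)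
  qed
  have gap: "z a < y" if "a < j" "j < 2 * k" for a
  proof -
    have "real a + 1 \<le> real j" using that by simp
    then have "(real a + 1) * pi \<le> real j * pi" by simp
    then have "real a * pi + pi \<le> real j * pi" by (simp add: distrib_right)
    with near[of a] that cell show ?thesis by linarith
  qed
  have gap': "y < z a" if "j < a" "a < 2 * k" for a
  proof -
    have "real j + 1 \<le> real a" using that by simp
    then have "(real j + 1) * pi \<le> real a * pi" by simp
    then have "real j * pi + pi \<le> real a * pi" by (simp add: distrib_right)
    with near[of a] that cell show ?thesis by linarith
  qed
  show ?thesis
  proof (cases "even j")
    case True
    then obtain i where i: "j = 2 * i" by blast
    have "(\<exists>i<k. z (2 * i) \<le> y \<and> y \<le> z (2 * i + 1)) \<longleftrightarrow> z j \<le> y"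
    proof
      assume "\<exists>i<k. z (2 * i) \<le> y \<and> y \<le> z (2 * i + 1)"
      then obtain l where l: "l < k" "z (2 * l) \<le> y" "y \<le> z (2 * l + 1)" by blast
      then have "\<not> 2 * l + 1 < j" "\<not> j < 2 * l"
        using gap[of "2 * l + 1"] gap'[of "2 * l"] jk by auto
      then have "l = i" using i by presburger
      with l i show "z j \<le> y" by simp
    next
      assume "z j \<le> y"
      moreover have "y < z (2 * i + 1)" using gap'[of "2 * i + 1"] i jk by simp
      ultimately show "\<exists>i<k. z (2 * i) \<le> y \<and> y \<le> z (2 * i + 1)"
        using i jk by (intro exI[of _ i]) auto
    qed
    with V True show ?thesis by simp
  next
    case False
    then obtain i where i: "j = 2 * i + 1" using oddE by blast
    have "(\<exists>i<k. z (2 * i) \<le> y \<and> y \<le> z (2 * i + 1)) \<longleftrightarrow> y \<le> z j"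
    proof
      assume "\<exists>i<k. z (2 * i) \<le> y \<and> y \<le> z (2 * i + 1)"
      then obtain l where l: "l < k" "z (2 * l) \<le> y" "y \<le> z (2 * l + 1)" by blast
      then have "\<not> 2 * l + 1 < j" "\<not> j < 2 * l"
        using gap[of "2 * l + 1"] gap'[of "2 * l"] jk by auto
      then have "l = i" using i by presburger
      with l i show "y \<le> z j" by simp
    next
      assume "y \<le> z j"
      moreover have "z (2 * i) < y" using gap[of "2 * i"] i jk by simp
      ultimately show "\<exists>i<k. z (2 * i) \<le> y \<and> y \<le> z (2 * i + 1)"
        using i jk by (intro exI[of _ i]) auto
    qed
    with V False show ?thesis by (auto simp: sgn_if split: if_splits)
  qed
qed

text \<open>
  A larger connected subset of \<open>V\<close> would also contain a point of one of the two gaps adjacent to the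
  interval.
\<close>

lemma interval_chain_component:
  fixes V :: "real set" and z :: "nat \<Rightarrow> real"
  assumes V: "\<And>y. 0 \<le> y \<Longrightarrow> y < B \<Longrightarrow> y \<in> V \<longleftrightarrow> (\<exists>i<k. z (2 * i) \<le> y \<and> y \<le> z (2 * i + 1))"
    and V0: "V \<subseteq> {0..}"
    and z0: "0 \<le> z 0" and mono: "\<And>a b. a < b \<Longrightarrow> b < 2 * k \<Longrightarrow> z a < z b"
    and B: "\<And>j. j < 2 * k \<Longrightarrow> z j < B"
    and i: "i < k"
  shows "{z (2 * i)..z (2 * i + 1)} \<in> components V"
proof -
  have nonneg: "0 \<le> z j" if "j < 2 * k" for j
    using mono[of 0 j] z0 that by (cases "j = 0") auto
  have sub: "{z (2 * i)..z (2 * i + 1)} \<subseteq> V"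
  proof
    fix y assume y: "y \<in> {z (2 * i)..z (2 * i + 1)}"
    then have "0 \<le> y" "y < B" using nonneg[of "2 * i"] B[of "2 * i + 1"] i by auto
    then show "y \<in> V" using V[of y] y i by auto
  qed
  have ne: "z (2 * i) < z (2 * i + 1)" using mono[of "2 * i" "2 * i + 1"] i by simp
  have max: "D = {z (2 * i)..z (2 * i + 1)}"
    if D: "connected D" "{z (2 * i)..z (2 * i + 1)} \<subseteq> D" "D \<subseteq> V" for D
  proof (rule ccontr)
    assume "D \<noteq> {z (2 * i)..z (2 * i + 1)}"
    then obtain x where x: "x \<in> D" "x < z (2 * i) \<or> z (2 * i + 1) < x"
      using D(2) by (metis atLeastAtMost_iff not_le subsetI subset_antisym)
    have between: "p \<in> V" if "u \<in> D" "v \<in> D" "u \<le> p" "p \<le> v" for u v p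
      using connectedD_interval[OF D(1) that] D(3) by blast
    from x(2) show False
    proof
      assume left: "x < z (2 * i)"
      \<comment> \<open>a point of the gap on the left, but not to the left of \<open>x\<close>\<close>
      define p where "p = (if i = 0 then x else max x ((z (2 * i - 1) + z (2 * i)) / 2))"
      have prev: "z (2 * i - 1) < z (2 * i)" if "i \<noteq> 0"
        using mono[of "2 * i - 1" "2 * i"] i that by simp
      have p: "x \<le> p" "p < z (2 * i)" "i \<noteq> 0 \<Longrightarrow> z (2 * i - 1) < p"
        using left prev by (auto simp: p_def less_max_iff_disj)
      have "p \<in> V" using between[of x "z (2 * i)" p] x(1) p(1,2) D(2) ne by (auto simp: subset_iff)
      moreover have "0 \<le> p" using V0 x(1) D(3) p(1) by (auto intro: order_trans[of 0 x])
      moreover have "p < B" using p B[of "2 * i"] i by simp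
      ultimately obtain l where l: "l < k" "z (2 * l) \<le> p" "p \<le> z (2 * l + 1)" using V by blast
      show False
      proof (cases "l < i")
        case True
        then have "z (2 * l + 1) \<le> z (2 * i - 1)"
          using mono[of "2 * l + 1" "2 * i - 1"] i
          by (cases "2 * l + 1 = 2 * i - 1") (simp, fastforce)
        with p l True show False by auto
      next
        case False
        then have "z (2 * i) \<le> z (2 * l)"
          using mono[of "2 * i" "2 * l"] l(1) by (cases "l = i") auto
        with p l show False by simp
      qed
    next
      assume right: "z (2 * i + 1) < x"
      \<comment> \<open>the right end of the gap on the right, or the bound up to which \<open>V\<close> is known\<close>
      define q where "q = (if i + 1 < k then z (2 * i + 2) else B)"
      have q: "z (2 * i + 1) < q" "q \<le> B"
        using mono[of "2 * i + 1" "2 * i + 2"] B[of "2 * i + 1"] B[of "2 * i + 2"] i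
        by (auto simp: q_def)
      define p where "p = min x ((z (2 * i + 1) + q) / 2)"
      have p: "p \<le> x" "p < q" "z (2 * i + 1) < p"
        using right q by (auto simp: p_def min_less_iff_disj)
      have "p \<in> V" using between[of "z (2 * i + 1)" x p] x(1) p(1,3) D(2) ne by (auto simp: subset_iff)
      moreover have "0 \<le> p" using p nonneg[of "2 * i + 1"] i by simp
      moreover have "p < B" using p q by simp
      ultimately obtain l where l: "l < k" "z (2 * l) \<le> p" "p \<le> z (2 * l + 1)" using V by blast
      show False
      proof (cases "l \<le> i")
        case True
        then have "z (2 * l + 1) \<le> z (2 * i + 1)"
          using mono[of "2 * l + 1" "2 * i + 1"] i by (cases "l = i") auto
        with p l show False by simp
      next
        case False
        then have "z (2 * i + 2) \<le> z (2 * l)" "q = z (2 * i + 2)"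
          using mono[of "2 * i + 2" "2 * l"] l(1) by (cases "l = i + 1"; simp add: q_def)+
        with p l show False by simp
      qed
    qed
  qed
  show ?thesis
    unfolding in_components_maximal using sub ne max by auto
qed

text \<open>
  The interval with index \<open>i\<close> is some \<open>Iint n L\<close>. The components to its left are
  \<open>Iint n 1, \<dots>, Iint n (L - 1)\<close> and also exactly the intervals with smaller index, because each of
  them meets the region where \<open>Vplus n\<close> is known. Counting them in both ways gives \<open>L - 1 = i\<close>.
\<close>

lemma Iint_interval_chain:
  fixes z :: "nat \<Rightarrow> real"
  assumes n: "n > 0"
    and V: "\<And>y. 0 \<le> y \<Longrightarrow> y < B \<Longrightarrow>
      y \<in> Vplus n \<longleftrightarrow> (\<exists>i<k. z (2 * i) \<le> y \<and> y \<le> z (2 * i + 1))"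
    and z0: "0 \<le> z 0" and mono: "\<And>a b. a < b \<Longrightarrow> b < 2 * k \<Longrightarrow> z a < z b"
    and B: "\<And>j. j < 2 * k \<Longrightarrow> z j < B"
    and i: "i < k"
  shows "Suc i \<le> k0 n" "Iint n (Suc i) = {z (2 * i)..z (2 * i + 1)}"
proof -
  define C where "C l = {z (2 * l)..z (2 * l + 1)}" for l
  have V0: "Vplus n \<subseteq> {0..}" by (auto simp: Vplus_def)
  have C: "C l \<in> components (Vplus n)" if "l < k" for l
    unfolding C_def using interval_chain_component[OF V V0 z0 mono B that] by simp
  note bij = Iint_enumerates(1)[OF n] and ordered = Iint_enumerates(5)[OF n]
  have ex: "\<exists>q. 1 \<le> q \<and> q \<le> k0 n \<and> Iint n q = D" if "D \<in> components (Vplus n)" for D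
  proof -
    have "D \<in> Iint n ` {1..k0 n}" using bij that by (simp add: bij_betw_def)
    then show ?thesis by auto
  qed
  obtain L where L: "1 \<le> L" "L \<le> k0 n" "Iint n L = C i" using ex[OF C[OF i]] by blast
  have left: "z (2 * l) \<in> C l" if "l < k" for l
    using mono[of "2 * l" "2 * l + 1"] that by (simp add: C_def)
  have incr: "z (2 * l) < z (2 * l') \<longleftrightarrow> l < l'" if "l < k" "l' < k" for l l'
    using mono[of "2 * l" "2 * l'"] mono[of "2 * l'" "2 * l"] that
    by (cases l l' rule: linorder_cases) auto
  have "Iint n ` {1..<L} = C ` {..<i}"
  proof (intro equalityI subsetI)
    fix D assume "D \<in> Iint n ` {1..<L}"
    then obtain q where q: "1 \<le> q" "q < L" "D = Iint n q" by auto
    have D: "D \<in> components (Vplus n)"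
      using bij q L unfolding bij_betw_def by auto
    obtain x where x: "x \<in> D" using in_components_nonempty[OF D] by blast
    have xi: "x < z (2 * i)"
      using ordered[of q L] q L left[OF i] x by auto
    have xV: "x \<in> Vplus n" using in_components_subset[OF D] x by blast
    have "0 \<le> x" "x < B" using V0 xV xi B[of "2 * i"] i by auto
    then obtain l where l: "l < k" "z (2 * l) \<le> x" "x \<le> z (2 * l + 1)" using V xV by blast
    then have "D \<inter> C l \<noteq> {}" using x by (auto simp: C_def)
    then have "D = C l" using components_nonoverlap[OF D C[OF l(1)]] by blast
    moreover have "l < i" using incr[OF l(1) i] l xi by simp
    ultimately show "D \<in> C ` {..<i}" by blast
  next
    fix D assume "D \<in> C ` {..<i}"
    then obtain l where l: "l < i" "D = C l" by blast
    then have lk: "l < k" using i by simp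
    obtain q where q: "1 \<le> q" "q \<le> k0 n" "Iint n q = C l" using ex[OF C[OF lk]] by blast
    have lt: "z (2 * l) < z (2 * i)" using incr[OF lk i] l by simp
    have "\<not> L < q" using ordered[of L q] L q left[OF i] left[OF lk] lt by force
    moreover have "L \<noteq> q" using L q left[OF lk] lt by (auto simp: C_def)
    ultimately have "q < L" by simp
    with q l show "D \<in> Iint n ` {1..<L}" by force
  qed
  moreover have "inj_on (Iint n) {1..<L}"
    using bij L unfolding bij_betw_def by (auto intro: inj_on_subset)
  moreover have "inj_on C {..<i}"
  proof (rule inj_onI)
    fix l l' assume l: "l \<in> {..<i}" "l' \<in> {..<i}" "C l = C l'"
    then have "z (2 * l) = z (2 * l')"
      using left[of l] left[of l'] i by (auto simp: C_def)
    then show "l = l'" using incr[of l l'] incr[of l' l] l i by auto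
  qed
  ultimately have "card {1..<L} = card {..<i}" by (metis card_image)
  then have "L = Suc i" using L by simp
  with L show "Suc i \<le> k0 n" "Iint n (Suc i) = {z (2 * i)..z (2 * i + 1)}" by (auto simp: C_def)
qed

lemma Iint_endpoints_near:
  assumes k: "k \<ge> 1" and d: "0 < d" "d < pi / 2" and n: "n > 0" "4 dvd n"
    and large: "\<And>j. j < 2 * k \<Longrightarrow>
      ((real j + 1) * pi + 1) * exp ((real j + 1) * pi) / real n < min (sin d) (cos d)"
  shows "k \<le> k0 n \<and> (\<exists>a b. a \<le> b \<and> Iint n k = {a..b} \<and>
    \<bar>a - (2 * real k - 2) * pi\<bar> < d \<and> \<bar>b - (2 * real k - 1) * pi\<bar> < d)"
proof -
  have "\<exists>z. \<bar>z - real j * pi\<bar> < d \<and> (\<forall>y. \<bar>y - real j * pi\<bar> \<le> pi / 2 \<longrightarrow>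
      sgn (tapered_sin n y) = (-1) ^ j * sgn (y - z))" if "j < 2 * k" for j
    using tapered_sin_sign[OF d n(1) large[OF that]] by metis
  then obtain z where z: "\<And>j. j < 2 * k \<Longrightarrow> \<bar>z j - real j * pi\<bar> < d"
    and sg: "\<And>j y. j < 2 * k \<Longrightarrow> \<bar>y - real j * pi\<bar> \<le> pi / 2 \<Longrightarrow>
      sgn (tapered_sin n y) = (-1) ^ j * sgn (y - z j)"
    by metis
  have "tapered_sin n 0 = 0" by (simp add: tapered_sin_def sum.atMost_shift)
  \<comment> \<open>so that \<open>Vplus n\<close> starts with the first interval and not with a gap\<close>
  then have z0: "z 0 = 0" using sg[of 0 0] k by (simp add: sgn_zero_iff)
  have near: "\<bar>z j - real j * pi\<bar> < pi / 2" if "j < 2 * k" for j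
    using z[OF that] d by simp
  have mono: "z a < z b" if "a < b" "b < 2 * k" for a b
  proof -
    have "real a + 1 \<le> real b" using that by simp
    then have "(real a + 1) * pi \<le> real b * pi" by simp
    then have "real a * pi + pi \<le> real b * pi" by (simp add: distrib_right)
    with near[of a] near[of b] that show ?thesis by linarith
  qed
  have B: "z j < (2 * real k - 1 / 2) * pi" if "j < 2 * k" for j
  proof -
    have "real j + 1 \<le> 2 * real k" using that by linarith
    then have "(real j + 1) * pi \<le> 2 * real k * pi" by (rule mult_right_mono) simp
    then have "real j * pi + pi \<le> 2 * real k * pi" by (simp add: distrib_right)
    moreover have "(2 * real k - 1 / 2) * pi = 2 * real k * pi - pi / 2"
      by (simp add: left_diff_distrib)
    ultimately show ?thesis using near[OF that] by linarith
  qed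
  have V: "y \<in> Vplus n \<longleftrightarrow> (\<exists>i<k. z (2 * i) \<le> y \<and> y \<le> z (2 * i + 1))"
    if "0 \<le> y" "y < (2 * real k - 1 / 2) * pi" for y
    by (rule Vplus_left_part[OF n(2) near sg that])
  have k': "k - 1 < k" "Suc (k - 1) = k" and z0': "0 \<le> z 0" using k z0 by auto
  have "k \<le> k0 n" "Iint n k = {z (2 * (k - 1))..z (2 * (k - 1) + 1)}"
    using Iint_interval_chain[OF n(1) V z0' mono B k'(1)] unfolding k'(2) by blast+
  moreover have "\<bar>z (2 * (k - 1)) - (2 * real k - 2) * pi\<bar> < d"
    "\<bar>z (2 * (k - 1) + 1) - (2 * real k - 1) * pi\<bar> < d"
    using z[of "2 * (k - 1)"] z[of "2 * (k - 1) + 1"] k by (simp_all add: of_nat_diff algebra_simps)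
  moreover have "z (2 * (k - 1)) \<le> z (2 * (k - 1) + 1)"
  proof -
    have "2 * (k - 1) + 1 < 2 * k" using k by linarith
    with mono[of "2 * (k - 1)" "2 * (k - 1) + 1"] show ?thesis by simp
  qed
  ultimately show ?thesis by blast
qed

lemma Least_atLeastAtMost: "a \<le> b \<Longrightarrow> (LEAST x. x \<in> {a..b}) = a" for a b :: "'a::order"
  by (rule Least_equality) auto

lemma Greatest_atLeastAtMost: "a \<le> b \<Longrightarrow> (GREATEST x. x \<in> {a..b}) = b" for a b :: "'a::order"
  by (rule Greatest_equality) auto

theorem theorem4p5:
  fixes k :: nat
  assumes "k \<ge> 1"
  shows "(\<forall>\<^sub>F m in sequentially. k0 (4 * m) \<ge> k) \<and>
    (\<lambda>m. LEAST x. x \<in> Iint (4 * m) k) \<longlonglongrightarrow> (2 * real k - 2) * pi \<and>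
    (\<lambda>m. GREATEST x. x \<in> Iint (4 * m) k) \<longlonglongrightarrow> (2 * real k - 1) * pi"
proof -
  have near: "\<forall>\<^sub>F m in sequentially. k \<le> k0 (4 * m) \<and>
      \<bar>(LEAST x. x \<in> Iint (4 * m) k) - (2 * real k - 2) * pi\<bar> < e \<and>
      \<bar>(GREATEST x. x \<in> Iint (4 * m) k) - (2 * real k - 1) * pi\<bar> < e" if "e > 0" for e
  proof -
    \<comment> \<open>\<open>pi / 4\<close> is an arbitrary bound below \<open>pi / 2\<close>, to keep \<open>cos d\<close> positive\<close>
    define d where "d = min e (pi / 4)"
    have d: "0 < d" "d < pi / 2" "d \<le> e"
      using that pi_gt_zero unfolding d_def by linarith+
    have pos: "0 < min (sin d) (cos d)"
      using d by (simp add: sin_gt_zero cos_gt_zero)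
    have lim: "(\<lambda>m. c / real (4 * m)) \<longlonglongrightarrow> 0" for c :: real
      using tendsto_mult_right_zero[OF lim_inverse_n, of "c / 4"] by (simp add: field_simps)
    have "\<forall>\<^sub>F m in sequentially. \<forall>j\<in>{..<2 * k}.
        ((real j + 1) * pi + 1) * exp ((real j + 1) * pi) / real (4 * m) < min (sin d) (cos d)"
      by (intro eventually_ball_finite ballI order_tendstoD(2)[OF lim pos]) simp
    then show ?thesis
      using eventually_gt_at_top[of 0]
    proof eventually_elim
      case (elim m)
      from elim have "k \<le> k0 (4 * m) \<and> (\<exists>a b. a \<le> b \<and> Iint (4 * m) k = {a..b} \<and>
          \<bar>a - (2 * real k - 2) * pi\<bar> < d \<and> \<bar>b - (2 * real k - 1) * pi\<bar> < d)"
        by (intro Iint_endpoints_near assms d(1,2)) auto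
      then show ?case
        using d(3) by (auto simp: Least_atLeastAtMost Greatest_atLeastAtMost simp del: atLeastAtMost_iff)
    qed
  qed
  show ?thesis
  proof (intro conjI)
    show "\<forall>\<^sub>F m in sequentially. k0 (4 * m) \<ge> k"
      using near[of 1] by (rule eventually_mono) auto
    show "(\<lambda>m. LEAST x. x \<in> Iint (4 * m) k) \<longlonglongrightarrow> (2 * real k - 2) * pi"
      by (rule tendstoI) (auto simp: dist_real_def intro: eventually_mono[OF near])
    show "(\<lambda>m. GREATEST x. x \<in> Iint (4 * m) k) \<longlonglongrightarrow> (2 * real k - 1) * pi"
      by (rule tendstoI) (auto simp: dist_real_def intro: eventually_mono[OF near])
  qed
qed

end
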